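(* Let the primitive time interval $(-\infty,+\infty)$ be partitioned into intervals $[c_i,c_{i+1})$, $i\in\mathbb{Z}$, with partition-point map $t^4$ and set of partition points $R_4$. Let $\mathbf{d}_4$ be a developmental paradigm defined on $R_4$, with associated bijection $\mathbf{f}^4:\mathbb{Z}\times\mathbb{N}\to\mathbf{d}_4$ and associated set $\mathbf{D}_4$ of finite conjunctions. Then for each $\lambda\in{}^*\mathbb{N}\setminus\mathbb{N}$, $\nu\in{}^*\mathbb{Z}^{\le 0}\setminus\mathbb{Z}^{\le 0}$ and $\gamma\in{}^*\mathbb{Z}^{\ge 0}\setminus\mathbb{Z}^{\ge 0}$ there are $w^4_{\nu\gamma\lambda}\in{}^*\mathbf{D}_4$ and a hyperfinite set $d^4_{\nu\gamma\lambda}\subset{}^*\mathbf{d}_4$ such that $$\mathbf{d}_4\subset d^4_{\nu\gamma\lambda}\subset{}^*\mathbf{S}(\{w^4_{\nu\gamma\lambda}\}).$$ Further, $x\in d^4_{\nu\gamma\lambda}$ if and only if there exist $i\in{}^*\mathbb{Z}$, $\nu\le i\le 0$, and $k\in{}^*\mathbb{Z}$, $0\le k\le\gamma$, and $j\in{}^*\mathbb{N}$, $j\le\lambda$, such that $x={}^*\mathbf{f}^4(i,j)$ or $x={}^*\mathbf{f}^4(k,j)$.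
   Context: **Language and coding.** $\mathbb{N}=\{0,1,2,\ldots\}$. $L$ is a denumerable language: nonempty finite strings (words) over a countable alphabet. Fix a bijection $\mathrm{i}:L\to\mathbb{N}$. A partial sequence is a function $[0,n]\to \mathrm{i}[L]$, $n\in\mathbb{N}$; two partial sequences are equivalent if joining (juxtaposing), in order, the words coded by their values gives the same word of $L$. $\mathcal{E}$ is the set of equivalence classes. The map $\Theta:L\to\mathcal{E}$ sending $w$ to the class of the one-term partial sequence with value $\mathrm{i}(w)$ is a bijection. It is extended to sets, relations and operators on $L$, and images under $\Theta$ are written in bold. Thus a set $d\subset L$ corresponds to $\mathbf{d}=\Theta[d]\subset\mathcal{E}$. **Nonstandard model.** $\mathcal{M}$ is the standard superstructure over $\mathbb{R}$, and ${}^*\mathcal{M}$ is a nonstandard model of it satisfying the transfer principle, with $\mathbb{N}\subsetneq{}^*\mathbb{N}$ and the standard $n\in\mathbb{N}$ identified with ${}^*n$. Each $x\in\mathcal{E}$ is a finite set of finite sequences of natural numbers and is identified with ${}^*x$, so $\mathbf{d}\subset{}^*\mathbf{d}$ for $\mathbf{d}\subset\mathcal{E}$. An internal set $A\subset{}^*B$ is hyperfinite if $A\in{}^*\mathcal{F}({}^*B)$, where $\mathcal{F}(B)$ is the set of finite subsets of $B$. **Partition points.** $(c_i)_{i\in\mathbb{Z}}$ is a strictly increasing family of rational numbers such that the intervals $[c_i,c_{i+1})$, $i\in\mathbb{Z}$, partition $(-\infty,+\infty)$. For each $i\in\mathbb{Z}$, $j\mapsto t^4(i,j)$ ($j\in\mathbb{N}$)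 is a strictly increasing sequence of rational numbers in $[c_i,c_{i+1})$ with $t^4(i,0)=c_i$ and $\lim_{j\to\infty}t^4(i,j)=c_{i+1}=t^4(i+1,0)$. So $t^4$ is an injection on $\mathbb{Z}\times\mathbb{N}$, and $R_4$ is its range. **Developmental paradigm.** A developmental paradigm defined on $R_4$ is the range $d_4\subset L$ of a bijection $F^4:R_4\to d_4$, where each word $F^4(r)$ contains the rational $r$ as a unique identifier. Put $f^4=F^4\circ t^4:\mathbb{Z}\times\mathbb{N}\to d_4$, a bijection; $\mathbf{f}^4:\mathbb{Z}\times\mathbb{N}\to\mathbf{d}_4$ is its embedded version. The members of $d_4$ are treated as propositional atoms, not containing the special connective symbol $\wedge$. **Conjunctions.** $\mathcal{F}'(d_4)$ is the set of finite subsets of $d_4$ having two or more members. For each $G\in\mathcal{F}'(d_4)$, list the members of $G$, without repetition, in one chosen order and place $\wedge$ between consecutive members. This gives one word $\mathcal{G}(G)\in L$, and $\mathcal{G}:\mathcal{F}'(d_4)\to L$ is an injection. $D_4=\{\mathcal{G}(G)\mid G\in\mathcal{F}'(d_4)\}$, and $\mathbf{D}_4=\Theta[D_4]$. **The operator $S$.** A finite consequence operator on $L$ is a map $C:\mathcal{P}(L)\to\mathcal{P}(L)$ with $X\subset C(X)=C(C(X))\subset L$ and $C(X)=\bigcup\{C(F)\mid F\in\mathcal{F}(X)\}$ for all $X\subset L$. $S$ is a fixed finite consequence operator on $L$, generated by a logic-system in which $\wedge$ is interpreted as "and"; it has the property that whenever $w=F^4(r)\wedge\cdots\wedge F^4(s)\in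 D_4$, all the conjuncts satisfy $\{F^4(r),\ldots,F^4(s)\}\subset S(\{w\})$. $\mathbf{S}$ is the corresponding operator on $\mathcal{P}(\mathcal{E})$, $\mathbf{S}(\Theta[X])=\Theta[S(X)]$. *)

theory Defs
  imports Complex_Main "HOL-Library.Extended_Nat" "HOL-Library.Countable_Set"
    "HOL-Library.Disjoint_Sets" "HOL-Library.Sublist"
begin

text \<open>Throughout, \<open>E x u\<close> reads ``\<open>x\<close> is an element of \<open>u\<close> in the sense of \<open>E\<close>''. The same
  definitions serve the standard structure and the nonstandard one. Ordered pairs are Kuratowski
  pairs.\<close>

definition elts :: "('x \<Rightarrow> 'x \<Rightarrow> bool) \<Rightarrow> 'x \<Rightarrow> 'x set" where
  "elts E u = {x. E x u}"

definition is_upair :: "('x \<Rightarrow> 'x \<Rightarrow> bool) \<Rightarrow> 'x \<Rightarrow> 'x \<Rightarrow> 'x \<Rightarrow> bool" where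
  "is_upair E u x y \<longleftrightarrow> elts E u = {x, y}"

definition is_pair :: "('x \<Rightarrow> 'x \<Rightarrow> bool) \<Rightarrow> 'x \<Rightarrow> 'x \<Rightarrow> 'x \<Rightarrow> bool" where
  "is_pair E p x y \<longleftrightarrow> (\<exists>a b. is_upair E a x x \<and> is_upair E b x y \<and> is_upair E p a b)"

definition sing :: "('x \<Rightarrow> 'x \<Rightarrow> bool) \<Rightarrow> 'x \<Rightarrow> 'x" where
  "sing E x = (THE s. is_upair E s x x)"

definition pair :: "('x \<Rightarrow> 'x \<Rightarrow> bool) \<Rightarrow> 'x \<Rightarrow> 'x \<Rightarrow> 'x" where
  "pair E x y = (THE p. is_pair E p x y)"

definition related :: "('x \<Rightarrow> 'x \<Rightarrow> bool) \<Rightarrow> 'x \<Rightarrow> 'x \<Rightarrow> 'x \<Rightarrow> bool" where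
  "related E r x y \<longleftrightarrow> (\<exists>p. is_pair E p x y \<and> E p r)"

definition app :: "('x \<Rightarrow> 'x \<Rightarrow> bool) \<Rightarrow> 'x \<Rightarrow> 'x \<Rightarrow> 'x" where
  "app E f x = (THE y. related E f x y)"

text \<open>\<open>level atm mem n\<close> is \<open>V\<^sub>n(\<real>)\<close>, where \<open>V\<^sub>0(\<real>) = \<real>\<close> (as atoms) and
  \<open>V\<^sub>n\<^sub>+\<^sub>1(\<real>) = V\<^sub>n(\<real>) \<union> \<P>(V\<^sub>n(\<real>))\<close>.\<close>

primrec level :: "(real \<Rightarrow> 'u) \<Rightarrow> ('u \<Rightarrow> 'u \<Rightarrow> bool) \<Rightarrow> nat \<Rightarrow> 'u set" where
  "level atm mem 0 = range atm"
| "level atm mem (Suc n) =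
     level atm mem n \<union> {u. u \<notin> range atm \<and> elts mem u \<subseteq> level atm mem n}"

text \<open>The following determines the structure up to isomorphism. For \<open>h = \<infinity>\<close> it is the standard
  superstructure \<open>V(\<real>) = (\<Union>n. V\<^sub>n(\<real>))\<close>. For finite \<open>h\<close> it is the truncation \<open>V\<^sub>h(\<real>)\<close>; this case is
  admitted because each \<open>V\<^sub>h(\<real>)\<close> is available as a HOL type, whereas the existence of a type as
  large as \<open>V(\<real>)\<close> is not provable in HOL (though it is consistent with it).\<close>

definition superstructure :: "enat \<Rightarrow> (real \<Rightarrow> 'u) \<Rightarrow> ('u \<Rightarrow> 'u \<Rightarrow> bool) \<Rightarrow> bool" where
  "superstructure h atm mem \<longleftrightarrow>
     inj atm \<and>
     (\<forall>r x. \<not> mem x (atm r)) \<and>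
     (\<forall>u v. u \<notin> range atm \<longrightarrow> v \<notin> range atm \<longrightarrow> elts mem u = elts mem v \<longrightarrow> u = v) \<and>
     (\<forall>u. \<exists>n. enat n \<le> h \<and> u \<in> level atm mem n) \<and>
     (\<forall>n A. enat n < h \<longrightarrow> A \<subseteq> level atm mem n \<longrightarrow> (\<exists>u. u \<notin> range atm \<and> elts mem u = A))"

text \<open>Bounded formulas of the language of set theory, with variables \<open>v\<^sub>0, v\<^sub>1, \<dots>\<close>;
  \<open>BAll x y \<phi>\<close> is \<open>\<forall>v\<^sub>x \<in> v\<^sub>y. \<phi>\<close>. Constants are values assigned to free variables.\<close>

datatype fm = Eq nat nat | Mem nat nat | Neg fm | And fm fm | BAll nat nat fm

primrec sat :: "('x \<Rightarrow> 'x \<Rightarrow> bool) \<Rightarrow> (nat \<Rightarrow> 'x) \<Rightarrow> fm \<Rightarrow> bool" where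
  "sat E e (Eq x y) \<longleftrightarrow> e x = e y"
| "sat E e (Mem x y) \<longleftrightarrow> E (e x) (e y)"
| "sat E e (Neg \<phi>) \<longleftrightarrow> \<not> sat E e \<phi>"
| "sat E e (And \<phi> \<psi>) \<longleftrightarrow> sat E e \<phi> \<and> sat E e \<psi>"
| "sat E e (BAll x y \<phi>) \<longleftrightarrow> (\<forall>a. E a (e y) \<longrightarrow> sat E (e(x := a)) \<phi>)"

text \<open>The standard structure has universe \<open>'u\<close>, atoms \<open>atm\<close> and membership \<open>mem\<close>; the nonstandard
  one has universe \<open>'v\<close> and membership \<open>smem\<close>; \<open>star\<close> is the map \<open>a \<mapsto> \<^sup>*a\<close>.\<close>

record ('u, 'v) nsm =
  atm :: "real \<Rightarrow> 'u"
  mem :: "'u \<Rightarrow> 'u \<Rightarrow> bool"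
  smem :: "'v \<Rightarrow> 'v \<Rightarrow> bool"
  star :: "'u \<Rightarrow> 'v"

definition mkset :: "('u, 'v) nsm \<Rightarrow> 'u set \<Rightarrow> 'u" where
  "mkset M A = (THE u. u \<notin> range (atm M) \<and> elts (mem M) u = A)"

definition real_set :: "('u, 'v) nsm \<Rightarrow> real set \<Rightarrow> 'u" where
  "real_set M X = mkset M (atm M ` X)"

text \<open>For a standard set \<open>u\<close>, \<open>star_elts M u\<close> is the collection of elements of \<open>\<^sup>*u\<close>, and
  \<open>std_elts M u\<close> is \<open>u\<close> itself, after the identification of each \<open>x \<in> u\<close> with \<open>\<^sup>*x\<close>.\<close>

definition star_elts :: "('u, 'v) nsm \<Rightarrow> 'u \<Rightarrow> 'v set" where
  "star_elts M u = elts (smem M) (star M u)"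

definition std_elts :: "('u, 'v) nsm \<Rightarrow> 'u \<Rightarrow> 'v set" where
  "std_elts M u = star M ` elts (mem M) u"

text \<open>Extensionality is only asked for nonempty collections, so that the nonstandard structure may
  have atoms. It may or may not contain external sets.\<close>

definition nonstandard_model :: "enat \<Rightarrow> ('u, 'v) nsm \<Rightarrow> bool" where
  "nonstandard_model h M \<longleftrightarrow>
     superstructure h (atm M) (mem M) \<and>
     (\<forall>x y. elts (smem M) x = elts (smem M) y \<longrightarrow> elts (smem M) x \<noteq> {} \<longrightarrow> x = y) \<and>
     (\<forall>\<phi> e. sat (mem M) e \<phi> \<longleftrightarrow> sat (smem M) (star M \<circ> e) \<phi>) \<and>
     std_elts M (real_set M \<nat>) \<subset> star_elts M (real_set M \<nat>)"

definition le_rel :: "('u, 'v) nsm \<Rightarrow> 'u" where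
  "le_rel M = mkset M {pair (mem M) (atm M x) (atm M y) | x y. x \<le> y}"

definition star_le :: "('u, 'v) nsm \<Rightarrow> 'v \<Rightarrow> 'v \<Rightarrow> bool" where
  "star_le M a b \<longleftrightarrow> related (smem M) (star M (le_rel M)) a b"

definition finite_subsets :: "('u, 'v) nsm \<Rightarrow> 'u \<Rightarrow> 'u" where
  "finite_subsets M B = mkset M (mkset M ` {X. X \<subseteq> elts (mem M) B \<and> finite X})"

definition hyperfinite :: "('u, 'v) nsm \<Rightarrow> 'v \<Rightarrow> 'u \<Rightarrow> bool" where
  "hyperfinite M A B \<longleftrightarrow>
     elts (smem M) A \<subseteq> star_elts M B \<and> A \<in> star_elts M (finite_subsets M B)"

definition words :: "'a set \<Rightarrow> 'a list set" where
  "words alph = {w. w \<noteq> [] \<and> set w \<subseteq> alph}"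

text \<open>A partial sequence \<open>[0,n] \<rightarrow> code ` words alph\<close> is represented by the nonempty list of its
  \<open>n + 1\<close> values.\<close>

definition partial_seqs :: "'a set \<Rightarrow> ('a list \<Rightarrow> nat) \<Rightarrow> nat list set" where
  "partial_seqs alph code = {xs. xs \<noteq> [] \<and> set xs \<subseteq> code ` words alph}"

definition joined :: "'a set \<Rightarrow> ('a list \<Rightarrow> nat) \<Rightarrow> nat list \<Rightarrow> 'a list" where
  "joined alph code xs = concat (map (inv_into (words alph) code) xs)"

definition seq_equiv :: "'a set \<Rightarrow> ('a list \<Rightarrow> nat) \<Rightarrow> (nat list \<times> nat list) set" where
  "seq_equiv alph code =
     {(xs, ys). xs \<in> partial_seqs alph code \<and> ys \<in> partial_seqs alph code \<and>
                joined alph code xs = joined alph code ys}"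

definition classes :: "'a set \<Rightarrow> ('a list \<Rightarrow> nat) \<Rightarrow> nat list set set" where
  "classes alph code = partial_seqs alph code // seq_equiv alph code"

definition Theta :: "'a set \<Rightarrow> ('a list \<Rightarrow> nat) \<Rightarrow> 'a list \<Rightarrow> nat list set" where
  "Theta alph code w = seq_equiv alph code `` {[code w]}"

definition embed_op ::
  "'a set \<Rightarrow> ('a list \<Rightarrow> nat) \<Rightarrow> ('a list set \<Rightarrow> 'a list set) \<Rightarrow> nat list set set \<Rightarrow> nat list set set"
  where
  "embed_op alph code S Y = Theta alph code ` S {w \<in> words alph. Theta alph code w \<in> Y}"

lemma Theta_eq:
  assumes "bij_betw code (words alph) (UNIV :: nat set)" and "w \<in> words alph"
  shows "Theta alph code w = {xs \<in> partial_seqs alph code. joined alph code xs = w}"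
proof -
  have "inv_into (words alph) code (code w) = w"
    using assms by (simp add: bij_betw_inv_into_left)
  then show ?thesis
    using assms(2) by (auto simp: Theta_def seq_equiv_def joined_def partial_seqs_def)
qed

lemma bij_betw_Theta:
  assumes bij: "bij_betw code (words alph) (UNIV :: nat set)"
  shows "bij_betw (Theta alph code) (words alph) (classes alph code)"
proof -
  let ?J = "joined alph code" and ?P = "partial_seqs alph code"
  have inv: "inv_into (words alph) code (code w) = w" if "w \<in> words alph" for w
    using bij that by (simp add: bij_betw_inv_into_left)
  have one: "[code w] \<in> ?P" "?J [code w] = w" if "w \<in> words alph" for w
    using that inv by (auto simp: partial_seqs_def joined_def)
  have J: "?J xs \<in> words alph" if "xs \<in> ?P" for xs
  proof -
    have "inv_into (words alph) code x \<in> words alph" if "x \<in> set xs" for x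
      using bij by (metis UNIV_I bij_betw_def inv_into_into)
    then show ?thesis
      using that by (cases xs) (auto simp: words_def partial_seqs_def joined_def)
  qed
  have cls: "seq_equiv alph code `` {xs} = Theta alph code (?J xs)" if "xs \<in> ?P" for xs
    unfolding Theta_eq[OF bij J[OF that]] using that by (auto simp: seq_equiv_def)
  have "inj_on (Theta alph code) (words alph)"
  proof (rule inj_onI)
    fix w v assume wv: "w \<in> words alph" "v \<in> words alph" "Theta alph code w = Theta alph code v"
    then have "[code w] \<in> Theta alph code v"
      using Theta_eq[OF bij wv(1)] one[OF wv(1)] by auto
    then show "w = v"
      using Theta_eq[OF bij wv(2)] one(2)[OF wv(1)] by auto
  qed
  moreover have "Theta alph code ` words alph = classes alph code"
  proof
    show "Theta alph code ` words alph \<subseteq> classes alph code"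
      using one(1) by (auto simp: classes_def Theta_def intro: quotientI)
    show "classes alph code \<subseteq> Theta alph code ` words alph"
      using cls J by (auto simp: classes_def elim!: quotientE)
  qed
  ultimately show ?thesis by (simp add: bij_betw_def)
qed

lemma embed_op_Theta:
  assumes "bij_betw code (words alph) (UNIV :: nat set)" and "X \<subseteq> words alph"
  shows "embed_op alph code S (Theta alph code ` X) = Theta alph code ` S X"
proof -
  have "inj_on (Theta alph code) (words alph)"
    using bij_betw_Theta[OF assms(1)] by (rule bij_betw_imp_inj_on)
  then have "{w \<in> words alph. Theta alph code w \<in> Theta alph code ` X} = X"
    using assms(2) by (auto dest: inj_onD)
  then show ?thesis by (simp add: embed_op_def)
qed

text \<open>These objects as members of the superstructure: a partial sequence is a set of ordered pairs
  \<open>(k, value at k)\<close> of natural numbers, a class is a set of partial sequences.\<close>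

definition seq_obj :: "('u, 'v) nsm \<Rightarrow> nat list \<Rightarrow> 'u" where
  "seq_obj M xs =
     mkset M {pair (mem M) (atm M (real k)) (atm M (real (xs ! k))) | k. k < length xs}"

definition class_obj :: "('u, 'v) nsm \<Rightarrow> nat list set \<Rightarrow> 'u" where
  "class_obj M x = mkset M (seq_obj M ` x)"

definition classes_obj :: "('u, 'v) nsm \<Rightarrow> nat list set set \<Rightarrow> 'u" where
  "classes_obj M X = mkset M (class_obj M ` X)"

definition map_obj :: "('u, 'v) nsm \<Rightarrow> (int \<Rightarrow> nat \<Rightarrow> nat list set) \<Rightarrow> 'u" where
  "map_obj M f =
     mkset M {pair (mem M) (pair (mem M) (atm M (real_of_int i)) (atm M (real j)))
                (class_obj M (f i j)) | i j. True}"

definition op_obj ::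
  "('u, 'v) nsm \<Rightarrow> nat list set set \<Rightarrow> (nat list set set \<Rightarrow> nat list set set) \<Rightarrow> 'u" where
  "op_obj M U T = mkset M {pair (mem M) (classes_obj M Y) (classes_obj M (T Y)) | Y. Y \<subseteq> U}"

definition partition_points :: "(int \<Rightarrow> rat) \<Rightarrow> (int \<Rightarrow> nat \<Rightarrow> rat) \<Rightarrow> bool" where
  "partition_points c t \<longleftrightarrow>
     strict_mono c \<and>
     disjoint_family (\<lambda>i. {real_of_rat (c i) ..< real_of_rat (c (i + 1))}) \<and>
     (\<Union>i. {real_of_rat (c i) ..< real_of_rat (c (i + 1))}) = UNIV \<and>
     (\<forall>i. strict_mono (t i) \<and> range (t i) \<subseteq> {c i ..< c (i + 1)} \<and> t i 0 = c i \<and>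
          (\<lambda>j. real_of_rat (t i j)) \<longlonglongrightarrow> real_of_rat (c (i + 1)))"

text \<open>\<open>ident r\<close> is the expression by which the rational \<open>r\<close> is rendered in the language; distinct
  rationals in \<open>R\<close> have distinct expressions, and \<open>ident r\<close> occurs in the word \<open>F r\<close>. The members
  of the paradigm \<open>d\<close> are atoms: they do not contain the connective \<open>cj\<close>.\<close>

definition developmental_paradigm ::
  "'a set \<Rightarrow> 'a \<Rightarrow> (rat \<Rightarrow> 'a list) \<Rightarrow> rat set \<Rightarrow> (rat \<Rightarrow> 'a list) \<Rightarrow> 'a list set \<Rightarrow> bool" where
  "developmental_paradigm alph cj ident R F d \<longleftrightarrow>
     d \<subseteq> words alph \<and> bij_betw F R d \<and>
     ident ` R \<subseteq> words alph \<and> inj_on ident R \<and> (\<forall>r\<in>R. sublist (ident r) (F r)) \<and>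
     (\<forall>w\<in>d. cj \<notin> set w)"

definition finsets2 :: "'b set \<Rightarrow> 'b set set" where
  "finsets2 d = {G. G \<subseteq> d \<and> finite G \<and> 2 \<le> card G}"

fun join_with :: "'a \<Rightarrow> 'a list list \<Rightarrow> 'a list" where
  "join_with cj [] = []"
| "join_with cj [w] = w"
| "join_with cj (w # v # ws) = w @ [cj] @ join_with cj (v # ws)"

definition chosen_orders :: "'a list set \<Rightarrow> ('a list set \<Rightarrow> 'a list list) \<Rightarrow> bool" where
  "chosen_orders d ordr \<longleftrightarrow> (\<forall>G\<in>finsets2 d. distinct (ordr G) \<and> set (ordr G) = G)"

definition conjunction :: "'a \<Rightarrow> ('a list set \<Rightarrow> 'a list list) \<Rightarrow> 'a list set \<Rightarrow> 'a list" where
  "conjunction cj ordr G = join_with cj (ordr G)"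

definition conjunctions ::
  "'a \<Rightarrow> ('a list set \<Rightarrow> 'a list list) \<Rightarrow> 'a list set \<Rightarrow> 'a list set" where
  "conjunctions cj ordr d = conjunction cj ordr ` finsets2 d"

definition finite_consequence_operator :: "'b set \<Rightarrow> ('b set \<Rightarrow> 'b set) \<Rightarrow> bool" where
  "finite_consequence_operator L C \<longleftrightarrow>
     (\<forall>X\<subseteq>L. X \<subseteq> C X \<and> C X = C (C X) \<and> C X \<subseteq> L \<and> C X = \<Union> {C F | F. F \<subseteq> X \<and> finite F})"

end

theory Submission
  imports Defs
begin

text \<open>For standard \<open>l \<noteq> 0\<close>, \<open>n \<le> 0 \<le> g\<close> the set \<open>{f(i,j) | n \<le> i \<le> g, j \<le> l}\<close> is a finite subset of
  \<open>d\<close> with at least two members, namely \<open>f(0,0) \<noteq> f(0,1)\<close>, so its conjunction \<open>w\<close> exists and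
  \<open>S({w})\<close> contains it. This is a bounded sentence about \<open>l, n, g\<close>; transfer it and instantiate it
  at infinite numbers, which lie beyond all the standard ones.\<close>

section \<open>Bounded formulas for Kuratowski pairs\<close>

text \<open>Formulas have no function symbols and only bounded quantifiers, whereas the conclusion
  uses \<open>pair\<close>, \<open>sing\<close> and \<open>app\<close>, which are descriptions by
  \<open>THE\<close>. The transferred sentence is therefore relational, each auxiliary pair or set
  of classes being drawn from an explicit standard set, and the descriptions are resolved afterwards
  inside the nonstandard structure. That structure is not assumed closed under pairing: existence of
  pairs, existence of values and single-valuedness of graphs are transferred as well. Uniqueness of
  pairs and singletons comes from extensionality for nonempty sets. The case \<open>l = 0\<close> is
  kept out of the sentence because with \<open>n = g = 0\<close> it leaves a single member, and
  conjunctions are formed from two or more.\<close>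

definition Disj :: "fm \<Rightarrow> fm \<Rightarrow> fm" where
  "Disj \<phi> \<psi> = Neg (And (Neg \<phi>) (Neg \<psi>))"

definition Imp :: "fm \<Rightarrow> fm \<Rightarrow> fm" where
  "Imp \<phi> \<psi> = Neg (And \<phi> (Neg \<psi>))"

definition Iff :: "fm \<Rightarrow> fm \<Rightarrow> fm" where
  "Iff \<phi> \<psi> = And (Imp \<phi> \<psi>) (Imp \<psi> \<phi>)"

definition BEx :: "nat \<Rightarrow> nat \<Rightarrow> fm \<Rightarrow> fm" where
  "BEx x y \<phi> = Neg (BAll x y (Neg \<phi>))"

text \<open>The successor of a sum of variables is a variable distinct from all of them.\<close>

definition Upair :: "nat \<Rightarrow> nat \<Rightarrow> nat \<Rightarrow> fm" where
  "Upair u x y =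
     (let z = Suc (u + x + y) in And (Mem x u) (And (Mem y u) (BAll z u (Disj (Eq z x) (Eq z y)))))"

definition Opair :: "nat \<Rightarrow> nat \<Rightarrow> nat \<Rightarrow> fm" where
  "Opair p x y =
     (let a = Suc (p + x + y); b = Suc a
      in BEx a p (BEx b p (And (Upair a x x) (And (Upair b x y) (Upair p a b)))))"

definition Rel :: "nat \<Rightarrow> nat \<Rightarrow> nat \<Rightarrow> fm" where
  "Rel r x y = (let p = Suc (r + x + y) in BEx p r (Opair p x y))"

lemma sat_Disj [simp]: "sat E e (Disj \<phi> \<psi>) \<longleftrightarrow> sat E e \<phi> \<or> sat E e \<psi>"
  by (simp add: Disj_def)

lemma sat_Imp [simp]: "sat E e (Imp \<phi> \<psi>) \<longleftrightarrow> (sat E e \<phi> \<longrightarrow> sat E e \<psi>)"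
  by (simp add: Imp_def)

lemma sat_Iff [simp]: "sat E e (Iff \<phi> \<psi>) \<longleftrightarrow> (sat E e \<phi> \<longleftrightarrow> sat E e \<psi>)"
  by (auto simp: Iff_def)

lemma sat_BEx [simp]: "sat E e (BEx x y \<phi>) \<longleftrightarrow> (\<exists>a. E a (e y) \<and> sat E (e(x := a)) \<phi>)"
  by (simp add: BEx_def)

lemma sat_Upair [simp]: "sat E e (Upair u x y) \<longleftrightarrow> is_upair E (e u) (e x) (e y)"
  by (auto simp: Upair_def Let_def is_upair_def elts_def)

text \<open>\<open>is_pair\<close> lets \<open>a\<close> and \<open>b\<close> range over the whole
  universe; being elements of the pair, they may be bounded by it. This makes pairing expressible by
  a bounded formula.\<close>

lemma sat_Opair [simp]: "sat E e (Opair p x y) \<longleftrightarrow> is_pair E (e p) (e x) (e y)"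
proof -
  have "E a (e p) \<and> E b (e p)" if "is_upair E (e p) a b" for a b
    using that by (auto simp: is_upair_def elts_def)
  then show ?thesis
    by (auto simp: Opair_def Let_def is_pair_def)
qed

lemma sat_Rel [simp]: "sat E e (Rel r x y) \<longleftrightarrow> related E (e r) (e x) (e y)"
  by (auto simp: Rel_def Let_def related_def)

section \<open>Uniqueness of Kuratowski pairs and of function values for an arbitrary membership
  relation\<close>

lemma is_pair_inject:
  assumes "is_pair E p x y" "is_pair E p x' y'"
  shows "x = x' \<and> y = y'"
proof -
  obtain a b a' b' where *:
    "elts E a = {x}" "elts E b = {x, y}" "elts E p = {a, b}"
    "elts E a' = {x'}" "elts E b' = {x', y'}" "elts E p = {a', b'}"
    using assms by (auto simp: is_pair_def is_upair_def)
  then have "{a, b} = {a', b'}" by simp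
  \<comment> \<open>Passing to the element sets turns the members of the pair into genuine HOL sets,
    where the classical Kuratowski argument applies.\<close>
  then have "{{x}, {x, y}} = {{x'}, {x', y'}}"
    using * by (metis image_empty image_insert)
  then show ?thesis by (auto simp: doubleton_eq_iff)
qed

text \<open>Single-valuedness arranged so that every quantifier outside \<open>is_pair\<close> has a
  bound. Restricting \<open>y'\<close> to \<open>B\<close> loses nothing, since the first clause
  already puts every second coordinate into \<open>B\<close>.\<close>

definition graph_in :: "('x \<Rightarrow> 'x \<Rightarrow> bool) \<Rightarrow> 'x \<Rightarrow> 'x \<Rightarrow> 'x \<Rightarrow> bool" where
  "graph_in E g A B \<longleftrightarrow>
     (\<forall>p. E p g \<longrightarrow> (\<exists>x. E x A \<and> (\<exists>y. E y B \<and> is_pair E p x y \<and>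
        (\<forall>p'. E p' g \<longrightarrow> (\<forall>y'. E y' B \<longrightarrow> is_pair E p' x y' \<longrightarrow> y' = y)))))"

lemma related_unique:
  assumes g: "graph_in E g A B" and "related E g x y" "related E g x y'"
  shows "y' = y"
proof -
  obtain p p' where p: "is_pair E p x y" "E p g" and p': "is_pair E p' x y'" "E p' g"
    using assms(2,3) by (auto simp: related_def)
  note graph = g[unfolded graph_in_def, THEN spec, THEN mp]
  have "E y' B"
    using graph[OF p'(2)] is_pair_inject[OF p'(1)] by auto
  moreover obtain x1 y1 where 1: "is_pair E p x1 y1"
    "\<forall>p'. E p' g \<longrightarrow> (\<forall>y'. E y' B \<longrightarrow> is_pair E p' x1 y' \<longrightarrow> y' = y1)"
    using graph[OF p(2)] by (elim exE conjE)
  ultimately show ?thesis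
    using is_pair_inject[OF p(1) 1(1)] p' by simp
qed

lemma app_eq:
  assumes "graph_in E g A B" "related E g x y"
  shows "app E g x = y"
  unfolding app_def using assms(2) related_unique[OF assms] by (rule the_equality)

text \<open>The form of extensionality shared by both structures. Pairs and singletons have members,
  so it determines them.\<close>

definition ext_nonempty :: "('x \<Rightarrow> 'x \<Rightarrow> bool) \<Rightarrow> bool" where
  "ext_nonempty E \<longleftrightarrow> (\<forall>x y. elts E x = elts E y \<longrightarrow> elts E x \<noteq> {} \<longrightarrow> x = y)"

lemma is_upair_unique: "ext_nonempty E \<Longrightarrow> is_upair E u x y \<Longrightarrow> is_upair E v x y \<Longrightarrow> u = v"
  by (simp add: ext_nonempty_def is_upair_def)

lemma is_pair_unique:
  assumes "ext_nonempty E" "is_pair E p x y" "is_pair E q x y"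
  shows "p = q"
proof -
  obtain a b a' b' where *: "is_upair E a x x" "is_upair E b x y" "is_upair E p a b"
    "is_upair E a' x x" "is_upair E b' x y" "is_upair E q a' b'"
    using assms(2,3) by (auto simp: is_pair_def)
  have "a = a'" "b = b'"
    using is_upair_unique[OF assms(1) *(1,4)] is_upair_unique[OF assms(1) *(2,5)] .
  with *(6) have "is_upair E q a b" by simp
  then show ?thesis by (rule is_upair_unique[OF assms(1) *(3)])
qed

lemma pair_eq: "ext_nonempty E \<Longrightarrow> is_pair E p x y \<Longrightarrow> pair E x y = p"
  unfolding pair_def using is_pair_unique by (intro the_equality)

lemma sing_eq: "ext_nonempty E \<Longrightarrow> is_upair E s x x \<Longrightarrow> sing E x = s"
  unfolding sing_def using is_upair_unique by (intro the_equality)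

section \<open>The sentences to be transferred\<close>

definition pairs_in :: "('x \<Rightarrow> 'x \<Rightarrow> bool) \<Rightarrow> 'x \<Rightarrow> 'x \<Rightarrow> 'x \<Rightarrow> bool" where
  "pairs_in E A B C \<longleftrightarrow>
     (\<forall>x. E x A \<longrightarrow> (\<forall>y. E y B \<longrightarrow> (\<exists>p. E p C \<and> is_pair E p x y)))"

definition total_on_in :: "('x \<Rightarrow> 'x \<Rightarrow> bool) \<Rightarrow> 'x \<Rightarrow> 'x \<Rightarrow> 'x \<Rightarrow> bool" where
  "total_on_in E g A B \<longleftrightarrow> (\<forall>x. E x A \<longrightarrow> (\<exists>y. E y B \<and> related E g x y))"

definition in_window ::
  "('x \<Rightarrow> 'x \<Rightarrow> bool) \<Rightarrow> 'x \<Rightarrow> 'x \<Rightarrow> 'x \<Rightarrow> 'x \<Rightarrow> 'x \<Rightarrow> 'x \<Rightarrow> 'x \<Rightarrow> 'x \<Rightarrow> 'x \<Rightarrow> 'x \<Rightarrow> bool" where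
  "in_window E N Z z0 le ZN f l n g x \<longleftrightarrow>
     (\<exists>i. E i Z \<and> (\<exists>k. E k Z \<and> (\<exists>j. E j N \<and>
        related E le n i \<and> related E le i z0 \<and> related E le z0 k \<and> related E le k g \<and>
        related E le j l \<and>
        ((\<exists>q. E q ZN \<and> is_pair E q i j \<and> related E f q x) \<or>
         (\<exists>q. E q ZN \<and> is_pair E q k j \<and> related E f q x)))))"

text \<open>\<open>P\<close> bounds the argument \<open>s\<close> and the value \<open>Y\<close> of
  the operator, so that the consequences of \<open>w\<close> are reached without an application
  term. The description of \<open>A\<close> is restricted to \<open>d\<close> for the sake of a
  bounded quantifier.\<close>

definition window_conjunction ::
  "('x \<Rightarrow> 'x \<Rightarrow> bool) \<Rightarrow> 'x \<Rightarrow> 'x \<Rightarrow> 'x \<Rightarrow> 'x \<Rightarrow> 'x \<Rightarrow> 'x \<Rightarrow> 'x \<Rightarrow> 'x \<Rightarrow> 'x \<Rightarrow> 'x \<Rightarrow> 'x \<Rightarrow> 'x \<Rightarrow> 'x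
     \<Rightarrow> bool" where
  "window_conjunction E N Z z0 le ZN f Zn Zp Fin D d P S \<longleftrightarrow>
     (\<forall>l. E l N \<longrightarrow> (\<forall>n. E n Zn \<longrightarrow> (\<forall>g. E g Zp \<longrightarrow> l \<noteq> z0 \<longrightarrow>
        (\<exists>A. E A Fin \<and> (\<exists>w. E w D \<and>
           (\<forall>x. E x A \<longrightarrow> E x d) \<and>
           (\<forall>x. E x d \<longrightarrow> (E x A \<longleftrightarrow> in_window E N Z z0 le ZN f l n g x)) \<and>
           (\<exists>s. E s P \<and> (\<exists>Y. E Y P \<and> is_upair E s w w \<and> related E S s Y \<and>
              (\<forall>x. E x A \<longrightarrow> E x Y))))))))"

section \<open>Transfer of relations and closure properties to the nonstandard structure\<close>

lemma transfer:
  assumes "nonstandard_model h M"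
  shows "sat (mem M) e \<phi> \<longleftrightarrow> sat (smem M) (\<lambda>n. star M (e n)) \<phi>"
  using assms by (simp add: nonstandard_model_def o_def)

lemma smem_ext: "nonstandard_model h M \<Longrightarrow> ext_nonempty (smem M)"
  by (simp add: nonstandard_model_def ext_nonempty_def)

text \<open>List lookup serves as the assignment here and in the transfers below: parameters occupy
  the first indices and bound variables start at the length of the list, so the unspecified values
  of \<open>(!)\<close> past its end are overwritten before they are read.\<close>

lemma star_mem: "nonstandard_model h M \<Longrightarrow> smem M (star M x) (star M y) \<longleftrightarrow> mem M x y"
  using transfer[of h M "(!) [x, y]" "Mem 0 1"] by simp

lemma star_is_pair:
  "nonstandard_model h M \<Longrightarrow>
     is_pair (smem M) (star M p) (star M x) (star M y) \<longleftrightarrow> is_pair (mem M) p x y"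
  using transfer[of h M "(!) [p, x, y]" "Opair 0 1 2"] by simp

lemma star_related:
  "nonstandard_model h M \<Longrightarrow>
     related (smem M) (star M r) (star M x) (star M y) \<longleftrightarrow> related (mem M) r x y"
  using transfer[of h M "(!) [r, x, y]" "Rel 0 1 2"] by simp

lemma star_graph_in:
  assumes "nonstandard_model h M" "graph_in (mem M) g A B"
  shows "graph_in (smem M) (star M g) (star M A) (star M B)"
  using transfer[OF assms(1), of "(!) [g, A, B]"
      "BAll 3 0 (BEx 4 1 (BEx 5 2 (And (Opair 3 4 5)
        (BAll 6 0 (BAll 7 2 (Imp (Opair 6 4 7) (Eq 7 5)))))))"] assms(2)
  by (simp add: graph_in_def)

lemma star_pairs_in:
  assumes "nonstandard_model h M" "pairs_in (mem M) A B C"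
  shows "pairs_in (smem M) (star M A) (star M B) (star M C)"
  using transfer[OF assms(1), of "(!) [A, B, C]" "BAll 3 0 (BAll 4 1 (BEx 5 2 (Opair 5 3 4)))"]
    assms(2)
  by (simp add: pairs_in_def)

lemma star_total_on_in:
  assumes "nonstandard_model h M" "total_on_in (mem M) g A B"
  shows "total_on_in (smem M) (star M g) (star M A) (star M B)"
  using transfer[OF assms(1), of "(!) [g, A, B]" "BAll 3 1 (BEx 4 2 (Rel 0 3 4))"] assms(2)
  by (simp add: total_on_in_def)

text \<open>Indices 0 to 5 are parameters; 13, 14, 15 and 18 carry \<open>l\<close>,
  \<open>n\<close>, \<open>g\<close> and \<open>x\<close>, bound by the enclosing
  \<open>Window_conjunction\<close>. The variables bound here start at 20.\<close>

definition In_window :: fm where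
  "In_window =
     BEx 20 1 (BEx 21 1 (BEx 22 0 (And (Rel 3 14 20) (And (Rel 3 20 2) (And (Rel 3 2 21)
       (And (Rel 3 21 15) (And (Rel 3 22 13)
         (Disj (BEx 23 4 (And (Opair 23 20 22) (Rel 5 23 18)))
               (BEx 23 4 (And (Opair 23 21 22) (Rel 5 23 18)))))))))))"

lemma sat_In_window [simp]:
  "sat E e In_window \<longleftrightarrow>
     in_window E (e 0) (e 1) (e 2) (e 3) (e 4) (e 5) (e 13) (e 14) (e 15) (e 18)"
  by (simp add: In_window_def in_window_def)

definition Window_conjunction :: fm where
  "Window_conjunction =
     BAll 13 0 (BAll 14 6 (BAll 15 7 (Imp (Neg (Eq 13 2))
       (BEx 16 8 (BEx 17 9 (And (BAll 18 16 (Mem 18 10)) (And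
         (BAll 18 10 (Iff (Mem 18 16) In_window))
         (BEx 19 11 (BEx 20 11 (And (Upair 19 17 17) (And (Rel 12 19 20)
           (BAll 18 16 (Mem 18 20)))))))))))))"

lemma sat_Window_conjunction:
  "sat E e Window_conjunction \<longleftrightarrow>
     window_conjunction E (e 0) (e 1) (e 2) (e 3) (e 4) (e 5) (e 6) (e 7) (e 8) (e 9) (e 10) (e 11)
       (e 12)"
  unfolding Window_conjunction_def window_conjunction_def sat.simps sat_Imp sat_Iff sat_BEx
    sat_Upair sat_Rel sat_In_window
  \<comment> \<open>Only the updated assignments are evaluated; the two sides then agree literally,
    including the order of the quantifiers.\<close>
  by (simp only: fun_upd_apply numeral_eq_iff zero_neq_numeral numeral_neq_zero num.simps
      one_eq_numeral_iff numeral_eq_one_iff if_False if_True simp_thms)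

lemma star_window_conjunction:
  assumes "nonstandard_model h M"
    "window_conjunction (mem M) N Z z0 le ZN f Zn Zp Fin D d P S"
  shows "window_conjunction (smem M) (star M N) (star M Z) (star M z0) (star M le) (star M ZN)
     (star M f) (star M Zn) (star M Zp) (star M Fin) (star M D) (star M d) (star M P) (star M S)"
  using transfer[OF assms(1), of "(!) [N, Z, z0, le, ZN, f, Zn, Zp, Fin, D, d, P, S]"
      Window_conjunction] assms(2)
  by (simp add: sat_Window_conjunction)

section \<open>The standard superstructure\<close>

context
  fixes h :: enat and M :: "('u, 'v) nsm"
  assumes model: "nonstandard_model h M" and height: "12 \<le> h"
begin

abbreviation (input) V where "V \<equiv> level (atm M) (mem M)"

lemma superstructure: "superstructure h (atm M) (mem M)"
  using model by (simp add: nonstandard_model_def)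

lemma inj_atm: "inj (atm M)"
  using superstructure by (simp add: superstructure_def)

lemma not_mem_atm [simp]: "\<not> mem M x (atm M r)"
  using superstructure by (simp add: superstructure_def)

text \<open>Atoms have no elements, so objects with equal nonempty element sets are sets, and for
  sets the superstructure is extensional.\<close>

lemma mem_ext: "ext_nonempty (mem M)"
proof -
  have "u = v" if "elts (mem M) u = elts (mem M) v" "elts (mem M) u \<noteq> {}" for u v
  proof -
    have "u \<notin> range (atm M)" "v \<notin> range (atm M)"
      using that by (auto simp: elts_def)
    then show ?thesis
      using superstructure that by (simp add: superstructure_def)
  qed
  then show ?thesis by (simp add: ext_nonempty_def)
qed

section \<open>Sets and pairs of bounded rank\<close>

lemma V_mono: "m \<le> n \<Longrightarrow> V m \<subseteq> V n"
  by (induction n rule: dec_induct) auto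

text \<open>Every subset of a level below the height is an element set, and
  \<open>12 \<le> h\<close>. The levels reached later are 3 for partial sequences, 4 for classes, 5
  for sets of classes, 6 for families of finite subsets, 7 for the partition map and 8 for the
  operator.\<close>

lemma mkset:
  assumes "A \<subseteq> V n" "n < 12"
  shows "elts (mem M) (mkset M A) = A" "mkset M A \<in> V (Suc n)"
proof -
  have "enat n < 12" using assms(2) by (simp add: numeral_eq_enat)
  then have "enat n < h" using height by (rule less_le_trans)
  then obtain u where u: "u \<notin> range (atm M)" "elts (mem M) u = A"
    using superstructure assms(1) unfolding superstructure_def by blast
  have "v = u" if "v \<notin> range (atm M) \<and> elts (mem M) v = A" for v
    using superstructure that u by (simp add: superstructure_def)
  then have "mkset M A = u"
    unfolding mkset_def using u by (intro the_equality conjI)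
  then show "elts (mem M) (mkset M A) = A" "mkset M A \<in> V (Suc n)"
    using u assms(1) by auto
qed

lemma mem_mkset: "A \<subseteq> V n \<Longrightarrow> n < 12 \<Longrightarrow> mem M x (mkset M A) \<longleftrightarrow> x \<in> A"
  using mkset(1)[of A n] by (auto simp: elts_def)

lemma upair_exists:
  assumes "x \<in> V n" "y \<in> V n" "n < 12"
  shows "\<exists>u\<in>V (Suc n). is_upair (mem M) u x y"
  unfolding is_upair_def using mkset[of "{x, y}" n] assms by blast

text \<open>A Kuratowski pair costs two levels, so \<open>mkset\<close> is used at \<open>n\<close>
  and at \<open>n + 1\<close>; hence the bound 11.\<close>

lemma pair:
  assumes "x \<in> V n" "y \<in> V n" "n < 11"
  shows "is_pair (mem M) (pair (mem M) x y) x y" "pair (mem M) x y \<in> V (n + 2)"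
proof -
  obtain a b where ab: "a \<in> V (Suc n)" "is_upair (mem M) a x x"
    "b \<in> V (Suc n)" "is_upair (mem M) b x y"
    using upair_exists[of x n x] upair_exists[of x n y] assms by auto
  obtain p where p: "p \<in> V (Suc (Suc n))" "is_upair (mem M) p a b"
    using upair_exists[of a "Suc n" b] ab assms by auto
  have "is_pair (mem M) p x y"
    using ab p by (auto simp: is_pair_def)
  with pair_eq[OF mem_ext this] p(1)
  show "is_pair (mem M) (pair (mem M) x y) x y" "pair (mem M) x y \<in> V (n + 2)"
    by simp_all
qed

lemma is_pair_iff:
  "x \<in> V n \<Longrightarrow> y \<in> V n \<Longrightarrow> n < 11 \<Longrightarrow> is_pair (mem M) p x y \<longleftrightarrow> p = pair (mem M) x y"
  using pair(1)[of x n y] pair_eq[OF mem_ext, of p x y] by auto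

lemma pair_inject:
  assumes "x \<in> V n" "y \<in> V n" "x' \<in> V n" "y' \<in> V n" "n < 11"
  shows "pair (mem M) x y = pair (mem M) x' y' \<longleftrightarrow> x = x' \<and> y = y'"
  using pair(1)[of x n y] pair(1)[of x' n y'] assms
    is_pair_inject[of "mem M" "pair (mem M) x y" x y x' y'] by auto

lemma related_iff:
  "x \<in> V n \<Longrightarrow> y \<in> V n \<Longrightarrow> n < 11 \<Longrightarrow>
     related (mem M) r x y \<longleftrightarrow> mem M (pair (mem M) x y) r"
  by (simp add: related_def is_pair_iff)

lemma atm_eq: "atm M r = atm M s \<longleftrightarrow> r = s"
  using inj_atm by (auto dest: injD)

lemma mem_real_set: "mem M x (real_set M X) \<longleftrightarrow> (\<exists>r\<in>X. x = atm M r)"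
proof -
  have "atm M ` X \<subseteq> V 0" by auto
  from mem_mkset[OF this] show ?thesis by (auto simp: real_set_def)
qed

lemma atom_pair_V: "pair (mem M) (atm M r) (atm M s) \<in> V 2"
  using pair(2)[of "atm M r" 0 "atm M s"] by (simp add: numeral_2_eq_2)

lemma related_le: "related (mem M) (le_rel M) (atm M r) (atm M s) \<longleftrightarrow> r \<le> s"
proof -
  have "{pair (mem M) (atm M x) (atm M y) | x y. x \<le> y} \<subseteq> V 2"
    using atom_pair_V by blast
  from mem_mkset[OF this] show ?thesis
    by (auto simp: related_iff[of _ 0] pair_inject[of _ 0] le_rel_def atm_eq)
qed

section \<open>Sequences, classes and maps as members of the superstructure\<close>

lemma seq_obj:
  "elts (mem M) (seq_obj M xs) =
     {pair (mem M) (atm M (real k)) (atm M (real (xs ! k))) | k. k < length xs}"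
  "seq_obj M xs \<in> V 3"
proof -
  have "{pair (mem M) (atm M (real k)) (atm M (real (xs ! k))) | k. k < length xs} \<subseteq> V 2"
    using atom_pair_V by blast
  from mkset[OF this] show
    "elts (mem M) (seq_obj M xs) =
     {pair (mem M) (atm M (real k)) (atm M (real (xs ! k))) | k. k < length xs}"
    "seq_obj M xs \<in> V 3"
    by (simp_all add: seq_obj_def del: level.simps)
qed

text \<open>The pairs in the object reveal the length and every entry. Injectivity climbs from here
  up to \<open>classes_obj\<close>, where it recovers the argument of the operator from its
  code.\<close>

lemma inj_seq_obj: "inj (seq_obj M)"
proof (rule injI)
  fix xs ys assume eq: "seq_obj M xs = seq_obj M ys"
  have in_iff: "pair (mem M) (atm M (real k)) (atm M (real v)) \<in> elts (mem M) (seq_obj M zs) \<longleftrightarrow>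
      k < length zs \<and> v = zs ! k" for k v zs
    by (auto simp: seq_obj(1) pair_inject[of _ 0] atm_eq)
  have iff: "k < length xs \<and> v = xs ! k \<longleftrightarrow> k < length ys \<and> v = ys ! k" for k v
    using in_iff[of k v xs] in_iff[of k v ys] eq by simp
  then have "k < length xs \<longleftrightarrow> k < length ys" for k by blast
  then have "length xs = length ys" by (metis linorder_neqE_nat less_irrefl)
  then show "xs = ys" using iff by (metis nth_equalityI)
qed

lemma class_obj:
  "elts (mem M) (class_obj M x) = seq_obj M ` x" "class_obj M x \<in> V 4"
proof -
  have "seq_obj M ` x \<subseteq> V 3" using seq_obj(2) by blast
  from mkset[OF this] show
    "elts (mem M) (class_obj M x) = seq_obj M ` x" "class_obj M x \<in> V 4"
    by (simp_all add: class_obj_def del: level.simps)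
qed

lemma inj_class_obj: "inj (class_obj M)"
  by (rule injI) (metis class_obj(1) inj_image_eq_iff inj_seq_obj)

lemma classes_obj:
  "elts (mem M) (classes_obj M X) = class_obj M ` X" "classes_obj M X \<in> V 5"
proof -
  have "class_obj M ` X \<subseteq> V 4" using class_obj(2) by blast
  from mkset[OF this] show
    "elts (mem M) (classes_obj M X) = class_obj M ` X" "classes_obj M X \<in> V 5"
    by (simp_all add: classes_obj_def del: level.simps)
qed

lemma mem_classes_obj: "mem M u (classes_obj M X) \<longleftrightarrow> u \<in> class_obj M ` X"
  using classes_obj(1)[of X] by (auto simp: elts_def)

lemma inj_classes_obj: "inj (classes_obj M)"
  by (rule injI) (metis classes_obj(1) inj_image_eq_iff inj_class_obj)

lemma mem_map_obj:
  "mem M p (map_obj M f) \<longleftrightarrow>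
     (\<exists>i j. p = pair (mem M) (pair (mem M) (atm M (real_of_int i)) (atm M (real j)))
                (class_obj M (f i j)))"
proof -
  have "{pair (mem M) (pair (mem M) (atm M (real_of_int i)) (atm M (real j)))
                (class_obj M (f i j)) | i j. True} \<subseteq> V 6"
    using pair(2)[of _ 4] class_obj(2) atom_pair_V V_mono[of 2 4] by fastforce
  from mem_mkset[OF this] show ?thesis by (auto simp: map_obj_def)
qed

lemma mem_op_obj:
  "mem M p (op_obj M U T) \<longleftrightarrow>
     (\<exists>Y. Y \<subseteq> U \<and> p = pair (mem M) (classes_obj M Y) (classes_obj M (T Y)))"
proof -
  have "{pair (mem M) (classes_obj M Y) (classes_obj M (T Y)) | Y. Y \<subseteq> U} \<subseteq> V 7"
    using pair(2)[of _ 5] classes_obj(2) by fastforce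
  from mem_mkset[OF this] show ?thesis by (auto simp: op_obj_def)
qed

text \<open>Finite subsets of an image are the images of finite subsets.\<close>

lemma mem_finite_subsets:
  "mem M u (finite_subsets M (classes_obj M X)) \<longleftrightarrow>
     (\<exists>Y\<subseteq>X. finite Y \<and> u = classes_obj M Y)"
proof -
  have *: "mkset M ` {Z. Z \<subseteq> class_obj M ` X \<and> finite Z} = classes_obj M ` {Y. Y \<subseteq> X \<and> finite Y}"
  proof -
    have "{Z. Z \<subseteq> class_obj M ` X \<and> finite Z} = (`) (class_obj M) ` {Y. Y \<subseteq> X \<and> finite Y}"
      by (auto dest: finite_subset_image)
    then show ?thesis by (simp add: image_image classes_obj_def)
  qed
  have "classes_obj M ` {Y. Y \<subseteq> X \<and> finite Y} \<subseteq> V 5"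
    using classes_obj(2) by blast
  from mem_mkset[OF this] show ?thesis
    by (auto simp: finite_subsets_def classes_obj(1) * simp del: level.simps)
qed

text \<open>Only bounded quantifiers transfer; these two sets bound the quantifiers over the arguments of the
  partition map and of the consequence operator.\<close>

definition "number_pairs =
  mkset M {pair (mem M) (atm M (real_of_int i)) (atm M (real j)) | i j. True}"

definition "class_sets = mkset M (range (classes_obj M))"

lemma mem_number_pairs:
  "mem M p number_pairs \<longleftrightarrow>
     (\<exists>i j. p = pair (mem M) (atm M (real_of_int i)) (atm M (real j)))"
proof -
  have "{pair (mem M) (atm M (real_of_int i)) (atm M (real j)) | i j. True} \<subseteq> V 2"
    using atom_pair_V by blast
  from mem_mkset[OF this] show ?thesis by (auto simp: number_pairs_def)
qed

lemma mem_class_sets: "mem M u class_sets \<longleftrightarrow> (\<exists>Y. u = classes_obj M Y)"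
proof -
  have "range (classes_obj M) \<subseteq> V 5" using classes_obj(2) by blast
  from mem_mkset[OF this] show ?thesis by (auto simp: class_sets_def)
qed

section \<open>The partition map and the consequence operator as functions within the
  structure\<close>

lemma related_map_obj:
  "related (mem M) (map_obj M f) (pair (mem M) (atm M (real_of_int i)) (atm M (real j))) y \<longleftrightarrow>
     y = class_obj M (f i j)"
proof -
  \<comment> \<open>Number pairs lie in level 2 and classes in level 4; \<open>pair\<close> expects
    both components in one common level.\<close>
  have V: "pair (mem M) (atm M r) (atm M s) \<in> V 4" for r s
    using atom_pair_V V_mono[of 2 4] by auto
  let ?q = "\<lambda>i j. pair (mem M) (atm M (real_of_int i)) (atm M (real j))"
  have q_eq: "?q i j = ?q i' j' \<longleftrightarrow> i = i' \<and> j = j'" for i j i' j'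
    by (auto simp: pair_inject[of _ 0] atm_eq)
  show ?thesis
  proof
    assume "related (mem M) (map_obj M f) (?q i j) y"
    then obtain i' j' where "is_pair (mem M) (pair (mem M) (?q i' j') (class_obj M (f i' j'))) (?q i j) y"
      by (auto simp: related_def mem_map_obj)
    with pair(1)[OF V class_obj(2), of "real_of_int i'" "real j'" "f i' j'"]
    have "?q i' j' = ?q i j \<and> class_obj M (f i' j') = y"
      using is_pair_inject by fastforce
    then show "y = class_obj M (f i j)" unfolding q_eq by auto
  next
    assume "y = class_obj M (f i j)"
    then show "related (mem M) (map_obj M f) (?q i j) y"
      unfolding related_def mem_map_obj using pair(1)[OF V class_obj(2)] by fastforce
  qed
qed

lemma related_op_obj:
  "related (mem M) (op_obj M U T) (classes_obj M Y) u \<longleftrightarrow> Y \<subseteq> U \<and> u = classes_obj M (T Y)"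
proof
  assume "related (mem M) (op_obj M U T) (classes_obj M Y) u"
  then obtain Y' where Y': "Y' \<subseteq> U"
    "is_pair (mem M) (pair (mem M) (classes_obj M Y') (classes_obj M (T Y'))) (classes_obj M Y) u"
    by (auto simp: related_def mem_op_obj)
  with pair(1)[OF classes_obj(2) classes_obj(2), of Y' "T Y'"]
  have "classes_obj M Y' = classes_obj M Y \<and> classes_obj M (T Y') = u"
    using is_pair_inject by fastforce
  then show "Y \<subseteq> U \<and> u = classes_obj M (T Y)"
    using Y'(1) inj_classes_obj by (auto dest: injD)
next
  assume "Y \<subseteq> U \<and> u = classes_obj M (T Y)"
  then show "related (mem M) (op_obj M U T) (classes_obj M Y) u"
    unfolding related_def mem_op_obj
    using pair(1)[OF classes_obj(2) classes_obj(2), of Y "T Y"] by auto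
qed

lemma graph_in_map_obj:
  assumes "\<And>i j. f i j \<in> X"
  shows "graph_in (mem M) (map_obj M f) number_pairs (classes_obj M X)"
proof -
  have V: "pair (mem M) (atm M r) (atm M s) \<in> V 4" for r s
    using atom_pair_V V_mono[of 2 4] by auto
  show ?thesis
    unfolding graph_in_def
  proof (intro allI impI)
    fix p assume "mem M p (map_obj M f)"
    then obtain i j where p: "p = pair (mem M) (pair (mem M) (atm M (real_of_int i)) (atm M (real j)))
                (class_obj M (f i j))" (is "p = pair _ ?q ?y")
      by (auto simp: mem_map_obj)
    have "is_pair (mem M) p ?q ?y"
      unfolding p by (rule pair(1)[OF V class_obj(2)]) simp
    moreover have "y' = ?y" if "mem M p' (map_obj M f)" "is_pair (mem M) p' ?q y'" for p' y'
      using related_map_obj[of f i j y'] that unfolding related_def by blast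
    moreover have "mem M ?q number_pairs" "mem M ?y (classes_obj M X)"
      using assms by (auto simp: mem_number_pairs mem_classes_obj)
    ultimately show "\<exists>x. mem M x number_pairs \<and> (\<exists>y. mem M y (classes_obj M X) \<and> is_pair (mem M) p x y \<and>
        (\<forall>p'. mem M p' (map_obj M f) \<longrightarrow> (\<forall>y'. mem M y' (classes_obj M X) \<longrightarrow> is_pair (mem M) p' x y' \<longrightarrow> y' = y)))"
      by blast
  qed
qed

lemma graph_in_op_obj: "graph_in (mem M) (op_obj M U T) class_sets class_sets"
  unfolding graph_in_def
proof (intro allI impI)
  fix p assume "mem M p (op_obj M U T)"
  then obtain Y where p: "p = pair (mem M) (classes_obj M Y) (classes_obj M (T Y))"
    by (auto simp: mem_op_obj)
  have "is_pair (mem M) p (classes_obj M Y) (classes_obj M (T Y))"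
    unfolding p by (rule pair(1)[OF classes_obj(2) classes_obj(2)]) simp
  moreover have "y' = classes_obj M (T Y)"
    if "mem M p' (op_obj M U T)" "is_pair (mem M) p' (classes_obj M Y) y'" for p' y'
    using related_op_obj[of U T Y y'] that unfolding related_def by blast
  moreover have "mem M (classes_obj M Y) class_sets" "mem M (classes_obj M (T Y)) class_sets"
    by (auto simp: mem_class_sets)
  ultimately show "\<exists>x. mem M x class_sets \<and> (\<exists>y. mem M y class_sets \<and> is_pair (mem M) p x y \<and>
      (\<forall>p'. mem M p' (op_obj M U T) \<longrightarrow> (\<forall>y'. mem M y' class_sets \<longrightarrow> is_pair (mem M) p' x y' \<longrightarrow> y' = y)))"
    by blast
qed

lemma pairs_in_number_pairs:
  "pairs_in (mem M) (real_set M \<int>) (real_set M \<nat>) number_pairs"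
  using pair(1)[of "atm M _" 0 "atm M _"]
  by (fastforce simp: pairs_in_def mem_real_set mem_number_pairs elim!: Ints_cases Nats_cases)

lemma total_on_in_map_obj:
  "(\<And>i j. f i j \<in> X) \<Longrightarrow> total_on_in (mem M) (map_obj M f) number_pairs (classes_obj M X)"
  by (auto simp: total_on_in_def mem_number_pairs related_map_obj mem_classes_obj)


section \<open>The sentence holds in the standard superstructure\<close>

text \<open>The intervals from \<open>n\<close> to 0 and from 0 to \<open>g\<close> cover the
  interval from \<open>n\<close> to \<open>g\<close>. Both indices must exist at once, and the idle
  one is taken to be 0, which is allowed because \<open>n \<le> 0\<close> and
  \<open>0 \<le> g\<close>.\<close>

lemma in_window_iff:
  assumes n: "n \<le> 0" and g: "0 \<le> g"
  shows "in_window (mem M) (real_set M \<nat>) (real_set M \<int>) (atm M 0) (le_rel M) number_pairs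
     (map_obj M f) (atm M (real l)) (atm M (real_of_int n)) (atm M (real_of_int g)) x \<longleftrightarrow>
     (\<exists>i\<in>{n..g}. \<exists>j\<le>l. x = class_obj M (f i j))" (is "?L \<longleftrightarrow> ?R")
proof -
  have pairs: "(\<exists>q. mem M q number_pairs \<and>
       is_pair (mem M) q (atm M (real_of_int i)) (atm M (real j)) \<and> related (mem M) (map_obj M f) q x)
     \<longleftrightarrow> x = class_obj M (f i j)" for i j
  proof -
    have "is_pair (mem M) q (atm M (real_of_int i)) (atm M (real j)) \<longleftrightarrow>
        q = pair (mem M) (atm M (real_of_int i)) (atm M (real j))" for q
      by (rule is_pair_iff[of _ 0]) simp_all
    then show ?thesis by (auto simp: related_map_obj mem_number_pairs)
  qed
  have Z: "(\<exists>u. mem M u (real_set M \<int>) \<and> Q u) \<longleftrightarrow> (\<exists>i. Q (atm M (real_of_int i)))" for Q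
    unfolding mem_real_set by (metis Ints_cases Ints_of_int)
  have N: "(\<exists>u. mem M u (real_set M \<nat>) \<and> Q u) \<longleftrightarrow> (\<exists>j. Q (atm M (real j)))" for Q
    unfolding mem_real_set by (metis Nats_cases of_nat_in_Nats)
  have "?L \<longleftrightarrow> (\<exists>i k j. n \<le> i \<and> i \<le> 0 \<and> 0 \<le> k \<and> k \<le> g \<and> j \<le> l \<and>
      (x = class_obj M (f i j) \<or> x = class_obj M (f k j)))"
    unfolding in_window_def Z N pairs by (simp add: related_le)
  also have "\<dots> \<longleftrightarrow> ?R"
  proof
    assume ?R
    then obtain i j where ij: "n \<le> i" "i \<le> g" "j \<le> l" "x = class_obj M (f i j)" by auto
    then show "\<exists>i k j. n \<le> i \<and> i \<le> 0 \<and> 0 \<le> k \<and> k \<le> g \<and> j \<le> l \<and>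
      (x = class_obj M (f i j) \<or> x = class_obj M (f k j))"
    proof (cases "i \<le> 0")
      case True
      then have "n \<le> i \<and> i \<le> 0 \<and> 0 \<le> (0::int) \<and> 0 \<le> g \<and> j \<le> l \<and>
        (x = class_obj M (f i j) \<or> x = class_obj M (f 0 j))"
        using ij g by simp
      then show ?thesis by blast
    next
      case False
      then have "n \<le> 0 \<and> 0 \<le> (0::int) \<and> 0 \<le> i \<and> i \<le> g \<and> j \<le> l \<and>
        (x = class_obj M (f 0 j) \<or> x = class_obj M (f i j))"
        using ij n by simp
      then show ?thesis by blast
    qed
  qed (use n g in force)
  finally show ?thesis .
qed

lemma conjunction_in_words:
  assumes "cj \<in> alph" "ws \<noteq> []" "set ws \<subseteq> words alph"
  shows "join_with cj ws \<in> words alph"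
  using assms by (induction cj ws rule: join_with.induct) (auto simp: words_def)

lemma standard_window_conjunction:
  fixes F :: "int \<Rightarrow> nat \<Rightarrow> 'a list"
  assumes code: "bij_betw code (words alph) UNIV" and cj: "cj \<in> alph"
    and d: "d \<subseteq> words alph" "d = (\<Union>i j. {F i j})" and F: "F 0 0 \<noteq> F 0 1"
    and orders: "chosen_orders d ordr"
    and S: "\<forall>G\<in>finsets2 d. G \<subseteq> S {conjunction cj ordr G}"
  shows "window_conjunction (mem M) (real_set M \<nat>) (real_set M \<int>) (atm M 0) (le_rel M) number_pairs
     (map_obj M (\<lambda>i j. Theta alph code (F i j)))
     (real_set M {z \<in> \<int>. z \<le> 0}) (real_set M {z \<in> \<int>. 0 \<le> z})
     (finite_subsets M (classes_obj M (Theta alph code ` d)))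
     (classes_obj M (Theta alph code ` conjunctions cj ordr d))
     (classes_obj M (Theta alph code ` d)) class_sets
     (op_obj M (classes alph code) (embed_op alph code S))"
  unfolding window_conjunction_def
proof (intro allI impI)
  let ?\<Theta> = "Theta alph code"
  fix l n g
  assume "mem M l (real_set M \<nat>)" "mem M n (real_set M {z \<in> \<int>. z \<le> 0})"
    "mem M g (real_set M {z \<in> \<int>. 0 \<le> z})" and "l \<noteq> atm M 0"
  then obtain l' n' g' where l: "l = atm M (real l')" "l' \<noteq> 0"
    and n: "n = atm M (real_of_int n')" "n' \<le> 0" and g: "g = atm M (real_of_int g')" "0 \<le> g'"
    by (fastforce simp: mem_real_set atm_eq elim!: Ints_cases Nats_cases)
  define G where "G = (\<lambda>(i, j). F i j) ` ({n'..g'} \<times> {..l'})"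
  define w where "w = conjunction cj ordr G"
  have "{F 0 0, F 0 1} \<subseteq> G"
    using l(2) n(2) g(2) by (force simp: G_def)
  moreover have fin: "finite G" by (simp add: G_def)
  ultimately have "2 \<le> card G"
    using F card_mono[of G "{F 0 0, F 0 1}"] by simp
  moreover have Gd: "G \<subseteq> d" using d(2) by (auto simp: G_def)
  ultimately have G: "G \<in> finsets2 d" using fin by (simp add: finsets2_def)
  then have "set (ordr G) = G" using orders by (simp add: chosen_orders_def)
  moreover have "ordr G \<noteq> []"
    using calculation \<open>2 \<le> card G\<close> by auto
  \<comment> \<open>The embedded operator decodes its argument along \<open>Theta\<close>, which is
    faithful on words, and its graph has as arguments only sets of classes of words. Both uses below
    rest on \<open>w\<close> being a word.\<close>
  ultimately have w: "w \<in> words alph"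
    using Gd d(1) cj unfolding w_def conjunction_def by (intro conjunction_in_words) auto
  let ?A = "classes_obj M (?\<Theta> ` G)" and ?w = "class_obj M (?\<Theta> w)"
  let ?s = "classes_obj M {?\<Theta> w}" and ?Y = "classes_obj M (?\<Theta> ` S {w})"
  have "{?\<Theta> w} \<subseteq> classes alph code"
    using bij_betw_Theta[OF code] w by (auto simp: bij_betw_def)
  moreover have "embed_op alph code S {?\<Theta> w} = ?\<Theta> ` S {w}"
    using embed_op_Theta[OF code, of "{w}" S] w by simp
  ultimately have rel: "related (mem M) (op_obj M (classes alph code) (embed_op alph code S)) ?s ?Y"
    by (simp add: related_op_obj)
  have up: "is_upair (mem M) ?s ?w ?w"
    by (simp add: is_upair_def classes_obj)
  have sub: "\<forall>x. mem M x ?A \<longrightarrow> mem M x ?Y"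
    using S G by (auto simp: mem_classes_obj w_def)
  have win: "mem M x ?A \<longleftrightarrow>
      in_window (mem M) (real_set M \<nat>) (real_set M \<int>) (atm M 0) (le_rel M) number_pairs
        (map_obj M (\<lambda>i j. ?\<Theta> (F i j))) l n g x" for x
    unfolding l(1) n(1) g(1) in_window_iff[OF n(2) g(2)] by (force simp: mem_classes_obj G_def)
  have "mem M ?A (finite_subsets M (classes_obj M (?\<Theta> ` d)))"
    unfolding mem_finite_subsets using fin Gd by blast
  moreover have "mem M ?w (classes_obj M (?\<Theta> ` conjunctions cj ordr d))"
    using G by (auto simp: mem_classes_obj conjunctions_def w_def)
  moreover have "\<forall>x. mem M x ?A \<longrightarrow> mem M x (classes_obj M (?\<Theta> ` d))"
    using Gd by (auto simp: mem_classes_obj)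
  moreover have "mem M ?s class_sets" "mem M ?Y class_sets"
    by (auto simp: mem_class_sets)
  ultimately show "\<exists>A. mem M A (finite_subsets M (classes_obj M (?\<Theta> ` d))) \<and>
     (\<exists>w. mem M w (classes_obj M (?\<Theta> ` conjunctions cj ordr d)) \<and>
        (\<forall>x. mem M x A \<longrightarrow> mem M x (classes_obj M (?\<Theta> ` d))) \<and>
        (\<forall>x. mem M x (classes_obj M (?\<Theta> ` d)) \<longrightarrow> (mem M x A \<longleftrightarrow>
          in_window (mem M) (real_set M \<nat>) (real_set M \<int>) (atm M 0) (le_rel M) number_pairs
            (map_obj M (\<lambda>i j. ?\<Theta> (F i j))) l n g x)) \<and>
        (\<exists>s. mem M s class_sets \<and> (\<exists>Y. mem M Y class_sets \<and> is_upair (mem M) s w w \<and>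
          related (mem M) (op_obj M (classes alph code) (embed_op alph code S)) s Y \<and>
          (\<forall>x. mem M x A \<longrightarrow> mem M x Y))))"
    using rel up sub win by blast
qed

section \<open>Infinite numbers\<close>

lemma star_le_star: "star_le M (star M (atm M r)) (star M (atm M s)) \<longleftrightarrow> r \<le> s"
  by (simp add: star_le_def star_related[OF model] related_le)

text \<open>The induction is external, over standard \<open>n\<close>. No integer lies strictly
  between \<open>n\<close> and \<open>n + 1\<close>, and for fixed \<open>n\<close> this is a
  bounded sentence; its transfer lifts the bound by one, because the nonstandard \<open>x\<close>
  differs from every standard number.\<close>

lemma infinite_ge:
  assumes "x \<in> star_elts M (real_set M {z \<in> \<int>. 0 \<le> z}) - std_elts M (real_set M {z \<in> \<int>. 0 \<le> z})"
    (is "x \<in> star_elts M ?X - _")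
  shows "star_le M (star M (atm M (real n))) x"
proof (induction n)
  case 0
  have "\<forall>z. mem M z ?X \<longrightarrow> related (mem M) (le_rel M) (atm M 0) z"
    by (auto simp: mem_real_set related_le)
  then show ?case
    using transfer[OF model, of "(!) [le_rel M, atm M 0, ?X]" "BAll 3 2 (Rel 0 1 3)"] assms
    by (simp add: star_elts_def elts_def star_le_def)
next
  case (Suc n)
  have "\<forall>z. mem M z ?X \<longrightarrow> related (mem M) (le_rel M) (atm M (real n)) z \<longrightarrow> z \<noteq> atm M (real n) \<longrightarrow>
      related (mem M) (le_rel M) (atm M (real (Suc n))) z"
  proof (intro allI impI)
    fix z assume "mem M z ?X" and z: "related (mem M) (le_rel M) (atm M (real n)) z" "z \<noteq> atm M (real n)"
    then obtain k where k: "z = atm M (real_of_int k)" by (auto simp: mem_real_set elim!: Ints_cases)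
    then have "int n \<le> k" "k \<noteq> int n" using z by (auto simp: related_le)
    then show "related (mem M) (le_rel M) (atm M (real (Suc n))) z"
      by (simp add: k related_le)
  qed
  then have "star_le M (star M (atm M (real n))) x \<longrightarrow> x \<noteq> star M (atm M (real n)) \<longrightarrow>
      star_le M (star M (atm M (real (Suc n)))) x"
    using transfer[OF model, of "(!) [le_rel M, atm M (real n), ?X, atm M (real (Suc n))]"
        "BAll 4 2 (Imp (Rel 0 1 4) (Imp (Neg (Eq 4 1)) (Rel 0 3 4)))"] assms
    by (simp add: star_elts_def elts_def star_le_def del: of_nat_Suc)
  moreover have "mem M (atm M (real n)) ?X" by (simp add: mem_real_set atm_eq)
  then have "x \<noteq> star M (atm M (real n))"
    using assms by (auto simp: std_elts_def elts_def)
  ultimately show ?case using Suc by blast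
qed

text \<open>The same external induction downwards, for \<open>nu\<close>: no integer lies strictly
  between \<open>-(n + 1)\<close> and \<open>-n\<close>.\<close>

lemma infinite_le:
  assumes "x \<in> star_elts M (real_set M {z \<in> \<int>. z \<le> 0}) - std_elts M (real_set M {z \<in> \<int>. z \<le> 0})"
    (is "x \<in> star_elts M ?X - _")
  shows "star_le M x (star M (atm M (- real n)))"
proof (induction n)
  case 0
  have "\<forall>z. mem M z ?X \<longrightarrow> related (mem M) (le_rel M) z (atm M 0)"
    by (auto simp: mem_real_set related_le)
  then show ?case
    using transfer[OF model, of "(!) [le_rel M, atm M 0, ?X]" "BAll 3 2 (Rel 0 3 1)"] assms
    by (simp add: star_elts_def elts_def star_le_def)
next
  case (Suc n)
  have "\<forall>z. mem M z ?X \<longrightarrow> related (mem M) (le_rel M) z (atm M (- real n)) \<longrightarrow> z \<noteq> atm M (- real n) \<longrightarrow>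
      related (mem M) (le_rel M) z (atm M (- real (Suc n)))"
  proof (intro allI impI)
    fix z assume "mem M z ?X" and z: "related (mem M) (le_rel M) z (atm M (- real n))" "z \<noteq> atm M (- real n)"
    then obtain k where k: "z = atm M (real_of_int k)" by (auto simp: mem_real_set elim!: Ints_cases)
    then have "k \<le> - int n" "k \<noteq> - int n" using z by (auto simp: related_le)
    then show "related (mem M) (le_rel M) z (atm M (- real (Suc n)))"
      by (simp add: k related_le)
  qed
  then have "star_le M x (star M (atm M (- real n))) \<longrightarrow> x \<noteq> star M (atm M (- real n)) \<longrightarrow>
      star_le M x (star M (atm M (- real (Suc n))))"
    using transfer[OF model, of "(!) [le_rel M, atm M (- real n), ?X, atm M (- real (Suc n))]"
        "BAll 4 2 (Imp (Rel 0 4 1) (Imp (Neg (Eq 4 1)) (Rel 0 4 3)))"] assms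
    by (simp add: star_elts_def elts_def star_le_def del: of_nat_Suc)
  moreover have "mem M (atm M (- real n)) ?X" by (simp add: mem_real_set atm_eq)
  then have "x \<noteq> star M (atm M (- real n))"
    using assms by (auto simp: std_elts_def elts_def)
  ultimately show ?case using Suc by blast
qed

end

text \<open>Makes \<open>infinite_ge\<close>, which speaks of nonnegative integers, available for
  \<open>lam\<close>.\<close>

lemma Nats_eq_nonneg_Ints: "(\<nat> :: real set) = {z \<in> \<int>. 0 \<le> z}"
  by (auto simp: Nats_altdef2)

section \<open>Instantiation at infinite parameters and return to functional notation\<close>

theorem theorem4p4:
  fixes M :: "('u, 'v) nsm" and h :: enat
    and alph :: "'a set" and code :: "'a list \<Rightarrow> nat" and cj :: 'a
    and c :: "int \<Rightarrow> rat" and t :: "int \<Rightarrow> nat \<Rightarrow> rat" and R :: "rat set"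
    and ident F :: "rat \<Rightarrow> 'a list" and d :: "'a list set"
    and ordr :: "'a list set \<Rightarrow> 'a list list"
    and S :: "'a list set \<Rightarrow> 'a list set"
    and f_obj d_obj D_obj S_obj N_obj Z_obj :: 'u and zero lam nu gam :: 'v
  assumes model: "nonstandard_model h M" "12 \<le> h"
    and language: "countable alph" "bij_betw code (words alph) UNIV" "cj \<in> alph"
    and partition: "partition_points c t" "R = range (\<lambda>(i, j). t i j)"
    and paradigm: "developmental_paradigm alph cj ident R F d"
    and orders: "chosen_orders d ordr"
    and S: "finite_consequence_operator (words alph) S"
      "\<forall>G\<in>finsets2 d. G \<subseteq> S {conjunction cj ordr G}"
    and embedded: "f_obj = map_obj M (\<lambda>i j. Theta alph code (F (t i j)))"
      "d_obj = classes_obj M (Theta alph code ` d)"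
      "D_obj = classes_obj M (Theta alph code ` conjunctions cj ordr d)"
      "S_obj = op_obj M (classes alph code) (embed_op alph code S)"
    and numbers: "N_obj = real_set M \<nat>" "Z_obj = real_set M \<int>" "zero = star M (atm M 0)"
    and lam: "lam \<in> star_elts M N_obj - std_elts M N_obj"
    and nu: "nu \<in> star_elts M (real_set M {z \<in> \<int>. z \<le> 0}) - std_elts M (real_set M {z \<in> \<int>. z \<le> 0})"
    and gam: "gam \<in> star_elts M (real_set M {z \<in> \<int>. 0 \<le> z}) - std_elts M (real_set M {z \<in> \<int>. 0 \<le> z})"
  shows "\<exists>w A. w \<in> star_elts M D_obj \<and> hyperfinite M A d_obj \<and>
    std_elts M d_obj \<subseteq> elts (smem M) A \<and>
    elts (smem M) A \<subseteq> elts (smem M) (app (smem M) (star M S_obj) (sing (smem M) w)) \<and>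
    (\<forall>x. x \<in> elts (smem M) A \<longleftrightarrow>
      (\<exists>i\<in>star_elts M Z_obj. \<exists>k\<in>star_elts M Z_obj. \<exists>j\<in>star_elts M N_obj.
         star_le M nu i \<and> star_le M i zero \<and> star_le M zero k \<and> star_le M k gam \<and>
         star_le M j lam \<and>
         (x = app (smem M) (star M f_obj) (pair (smem M) i j) \<or>
          x = app (smem M) (star M f_obj) (pair (smem M) k j))))"
proof -
  let ?\<Theta> = "Theta alph code"
  let ?f = "\<lambda>i j. ?\<Theta> (F (t i j))"
  let ?E = "smem M" and ?N = "star M N_obj" and ?Z = "star M Z_obj" and ?f' = "star M f_obj"
  let ?ZN = "star M (number_pairs M)" and ?PE = "star M (class_sets M)"
  have bijF: "bij_betw F R d" and d: "d \<subseteq> words alph"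
    using paradigm by (auto simp: developmental_paradigm_def)
  then have d_eq: "d = (\<Union>i j. {F (t i j)})"
    using partition(2) by (auto simp: bij_betw_def)
  have "strict_mono (t 0)" using partition(1) by (simp add: partition_points_def)
  then have "t 0 0 \<noteq> t 0 1" by (simp add: strict_mono_eq)
  moreover have "t 0 0 \<in> R" "t 0 1 \<in> R" using partition(2) by auto
  ultimately have F: "F (t 0 0) \<noteq> F (t 0 1)"
    using bijF by (metis bij_betw_inv_into_left)
  have f: "?f i j \<in> ?\<Theta> ` d" for i j using d_eq by blast

  have graph_f: "graph_in ?E ?f' ?ZN (star M d_obj)"
    unfolding embedded by (intro star_graph_in[OF model(1)] graph_in_map_obj[OF model] f)
  have graph_S: "graph_in ?E (star M S_obj) ?PE ?PE"
    unfolding embedded by (intro star_graph_in[OF model(1)] graph_in_op_obj[OF model])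
  have pairs: "pairs_in ?E ?Z ?N ?ZN"
    unfolding numbers by (intro star_pairs_in[OF model(1)] pairs_in_number_pairs[OF model])
  have total: "total_on_in ?E ?f' ?ZN (star M d_obj)"
    unfolding embedded by (intro star_total_on_in[OF model(1)] total_on_in_map_obj[OF model] f)
  note ext = smem_ext[OF model(1)]

  \<comment> \<open>The bridge from relations to \<open>THE\<close> terms: transferred closure and
    totality supply a pair and a value, extensionality and single-valuedness make them unique, so
    \<open>pair\<close> and \<open>app\<close> denote them.\<close>
  have app_f: "(\<exists>q. ?E q ?ZN \<and> is_pair ?E q i j \<and> related ?E ?f' q x) \<longleftrightarrow>
      x = app ?E ?f' (pair ?E i j)" and app_d: "?E (app ?E ?f' (pair ?E i j)) (star M d_obj)"
    if ij: "?E i ?Z" "?E j ?N" for i j x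
  proof -
    obtain q where q: "?E q ?ZN" "is_pair ?E q i j"
      using pairs ij unfolding pairs_in_def by blast
    obtain y where y: "?E y (star M d_obj)" "related ?E ?f' q y"
      using total q(1) unfolding total_on_in_def by blast
    have "pair ?E i j = q" using pair_eq[OF ext q(2)] .
    moreover have "app ?E ?f' q = y" using app_eq[OF graph_f y(2)] .
    ultimately show "(\<exists>q. ?E q ?ZN \<and> is_pair ?E q i j \<and> related ?E ?f' q x) \<longleftrightarrow>
      x = app ?E ?f' (pair ?E i j)" "?E (app ?E ?f' (pair ?E i j)) (star M d_obj)"
      using q y app_eq[OF graph_f] is_pair_unique[OF ext] by metis+
  qed

  have mem_lam: "?E lam ?N" using lam by (simp add: star_elts_def elts_def)
  \<comment> \<open>0 is standard, so \<open>lam\<close> avoids the case excluded from the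
    sentence.\<close>
  have "lam \<noteq> zero"
  proof
    assume "lam = zero"
    moreover have "mem M (atm M 0) N_obj" by (auto simp: numbers mem_real_set[OF model])
    ultimately show False using lam numbers(3) by (auto simp: std_elts_def elts_def)
  qed
  moreover have "window_conjunction ?E ?N ?Z zero (star M (le_rel M)) ?ZN ?f'
     (star M (real_set M {z \<in> \<int>. z \<le> 0})) (star M (real_set M {z \<in> \<int>. 0 \<le> z}))
     (star M (finite_subsets M d_obj)) (star M D_obj) (star M d_obj) ?PE (star M S_obj)"
    unfolding numbers embedded
    by (intro star_window_conjunction[OF model(1)]
        standard_window_conjunction[OF model language(2,3) d d_eq F orders S(2)])
  ultimately obtain A w s Y where A: "?E A (star M (finite_subsets M d_obj))"
    and w: "?E w (star M D_obj)" and Ad: "\<And>x. ?E x A \<Longrightarrow> ?E x (star M d_obj)"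
    and win: "\<And>x. ?E x (star M d_obj) \<Longrightarrow> ?E x A \<longleftrightarrow>
       in_window ?E ?N ?Z zero (star M (le_rel M)) ?ZN ?f' lam nu gam x"
    and s: "is_upair ?E s w w" "related ?E (star M S_obj) s Y" and AY: "\<And>x. ?E x A \<Longrightarrow> ?E x Y"
    using mem_lam nu gam unfolding window_conjunction_def star_elts_def elts_def by blast
  have Y: "app ?E (star M S_obj) (sing ?E w) = Y"
    using sing_eq[OF ext s(1)] app_eq[OF graph_S s(2)] by simp

  let ?W = "\<lambda>x. \<exists>i\<in>star_elts M Z_obj. \<exists>k\<in>star_elts M Z_obj. \<exists>j\<in>star_elts M N_obj.
         star_le M nu i \<and> star_le M i zero \<and> star_le M zero k \<and> star_le M k gam \<and>
         star_le M j lam \<and>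
         (x = app ?E ?f' (pair ?E i j) \<or> x = app ?E ?f' (pair ?E k j))"
  have "in_window ?E ?N ?Z zero (star M (le_rel M)) ?ZN ?f' lam nu gam x \<longleftrightarrow> ?W x" for x
    unfolding in_window_def star_le_def star_elts_def elts_def Bex_def mem_Collect_eq
    using app_f by (intro ex_cong1 conj_cong refl) auto
  \<comment> \<open>Transfer describes \<open>A\<close> only among the elements of the extension of
    \<open>d\<close>. The extended map takes its values there, so the description extends to all
    \<open>x\<close>.\<close>
  moreover have "?W x \<Longrightarrow> ?E x (star M d_obj)" for x
    using app_d by (auto simp: star_elts_def elts_def)
  ultimately have A_iff: "?E x A \<longleftrightarrow> ?W x" for x
    using win Ad by blast

  have standard_mem: "?E x A" if x: "x \<in> std_elts M d_obj" for x
  proof -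
    obtain i j where ij: "x = star M (class_obj M (?f i j))"
      using x d_eq by (auto simp: std_elts_def embedded classes_obj[OF model])
    let ?i = "star M (atm M (real_of_int i))" and ?j = "star M (atm M (real j))"
    let ?q = "pair (mem M) (atm M (real_of_int i)) (atm M (real j))"
    have Z: "star M (atm M (real_of_int k)) \<in> star_elts M Z_obj" for k
      by (auto simp: star_elts_def elts_def star_mem[OF model(1)] numbers mem_real_set[OF model])
    have j: "?j \<in> star_elts M N_obj"
      by (auto simp: star_elts_def elts_def star_mem[OF model(1)] numbers mem_real_set[OF model])
    \<comment> \<open>At standard indices the nonstandard pair is the star of the standard one, so
      the extended map returns the star of the standard value.\<close>
    have "is_pair ?E (star M ?q) ?i ?j"
      using pair(1)[OF model, of "atm M _" 0 "atm M _"] by (simp add: star_is_pair[OF model(1)])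
    moreover have "related ?E ?f' (star M ?q) x"
      by (simp add: ij star_related[OF model(1)] embedded related_map_obj[OF model])
    ultimately have x_eq: "x = app ?E ?f' (pair ?E ?i ?j)"
      using pair_eq[OF ext] app_eq[OF graph_f] by metis
    have le: "star_le M ?j lam"
      using infinite_ge[OF model] lam unfolding numbers Nats_eq_nonneg_Ints by blast
    have nu_le: "star_le M nu (star M (atm M (- real m)))" for m
      using infinite_le[OF model nu] .
    have le_gam: "star_le M (star M (atm M (real m))) gam" for m
      using infinite_ge[OF model gam] .
    have "?W x"
    \<comment> \<open>A standard \<open>i\<close> falls in one of the two halves and 0 serves as the
      other index. The comparison with \<open>nu\<close> or \<open>gam\<close> uses the natural
      number \<open>nat (- i)\<close> or \<open>nat i\<close>.\<close>
    proof (cases "i \<le> 0")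
      case True
      then have "real_of_int i = - real (nat (- i))" by simp
      then have "star_le M nu ?i" "star_le M ?i zero" "star_le M zero zero" "star_le M zero gam"
        using nu_le[of "nat (- i)"] le_gam[of 0] True by (simp_all add: numbers star_le_star[OF model])
      then show ?thesis using Z[of i] Z[of 0] j le x_eq numbers(3) by auto
    next
      case False
      then have "real_of_int i = real (nat i)" by simp
      then have "star_le M nu zero" "star_le M zero zero" "star_le M zero ?i" "star_le M ?i gam"
        using nu_le[of 0] le_gam[of "nat i"] False by (simp_all add: numbers star_le_star[OF model])
      then show ?thesis using Z[of i] Z[of 0] j le x_eq numbers(3) by auto
    qed
    then show ?thesis using A_iff by blast
  qed

  show ?thesis
  proof (intro exI conjI allI)
    show "w \<in> star_elts M D_obj" using w by (simp add: star_elts_def elts_def)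
    show "hyperfinite M A d_obj"
      using A Ad by (auto simp: hyperfinite_def star_elts_def elts_def)
    show "std_elts M d_obj \<subseteq> elts ?E A" using standard_mem by (auto simp: elts_def)
    show "elts ?E A \<subseteq> elts ?E (app ?E (star M S_obj) (sing ?E w))"
      using AY by (auto simp: Y elts_def)
    show "x \<in> elts ?E A \<longleftrightarrow> ?W x" for x
      using A_iff by (simp add: elts_def)
  qed
qed

end
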